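(* Let $m\in\mathbb{N}$, let $\eta$ be a finite binomid index of length $m$, let $\tilde\eta$ be its lex-minimal extension, and let $(S_i)_{i\ge 1}$ be the sequence of partial sums of $\tilde\eta$. Then for all $k\ge 1$ there exists a sequence of nonnegative integers $(n_i)_{i\le m}\in \mathbf{UKP}[(S_i)_{i\le m};(i)_{i\le m};k]$ such that \[S_k=\sum_{i=1}^m n_iS_i \qquad\text{and}\qquad k=\sum_{i=1}^m n_i\, i .\]
   Context: $\mathbb{N}=\{1,2,3,\dots\}$ and $\mathbb{N}_0=\mathbb{N}\cup\{0\}$. A sequence $(e_i)_{i\le m}$ of nonnegative integers, where $m\in\mathbb{N}$ (finite sequence of length $m$) or $m=\infty$ (infinite sequence indexed by $\mathbb{N}$), is a binomid index if $\sum_{i=n-k+1}^{n}e_i\ge\sum_{i=1}^k e_i$ for all $k,n\in\mathbb{N}$ with $1\le k\le n\le m$. Every finite binomid index $\eta$ extends to an infinite binomid index having $\eta$ as its initial segment; among all such extensions there is a unique lexicographically minimal one, denoted $\tilde\eta$ and called the lex-minimal extension of $\eta$. The partial sums of $(e_i)_{i\ge1}$ are $S_i=e_1+\dots+e_i$. Unbounded knapsack problem: given sequences $v=(v_i)_{i\le m}$, $w=(w_i)_{i\le m}$ of nonnegative integers and $k\in\mathbb{N}$, $\mathbf{UKP}[v;w;k]$ denotes the set of all sequences $(n_i)_{i\le m}$ of nonnegative integers that maximize $\sum_{i=1}^m n_iv_i$ among all sequences of nonnegative integers subject to the constraint $\sum_{i=1}^m n_iw_i\le k$. *)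

theory Defs
  imports "HOL-Library.Extended_Nat" "HOL-Library.FuncSet" "HOL-Library.Fun_Lexorder"
begin

text \<open>
  A sequence \<open>(e\<^sub>i)\<^sub>i\<^sub>\<le>\<^sub>m\<close>, where \<open>m\<close> is finite or \<open>\<infinity>\<close>, is indexed from 1 and represented by a
  function that is \<^const>\<open>undefined\<close> outside its index set (in particular at 0), so that
  equality of functions is equality of sequences.
\<close>

definition nat_seqs :: "enat \<Rightarrow> (nat \<Rightarrow> nat) set" where
  "nat_seqs m = {i. 1 \<le> i \<and> enat i \<le> m} \<rightarrow>\<^sub>E UNIV"

definition binomid_index :: "enat \<Rightarrow> (nat \<Rightarrow> nat) \<Rightarrow> bool" where
  "binomid_index m e \<longleftrightarrow> e \<in> nat_seqs m \<and>
     (\<forall>k n. 1 \<le> k \<longrightarrow> k \<le> n \<longrightarrow> enat n \<le> m \<longrightarrow>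
        (\<Sum>i = n - k + 1..n. e i) \<ge> (\<Sum>i = 1..k. e i))"

definition binomid_extension :: "nat \<Rightarrow> (nat \<Rightarrow> nat) \<Rightarrow> (nat \<Rightarrow> nat) \<Rightarrow> bool" where
  "binomid_extension m \<eta> e \<longleftrightarrow> binomid_index \<infinity> e \<and> (\<forall>i\<in>{1..m}. e i = \<eta> i)"

text \<open>
  \<^const>\<open>less_fun\<close> is the strict lexicographic order on functions. It also compares the values
  at 0, but these agree for all sequences. The description is justified by
  \<open>lex_min_extension_unique\<close> below.
\<close>

definition lex_min_extension :: "nat \<Rightarrow> (nat \<Rightarrow> nat) \<Rightarrow> nat \<Rightarrow> nat" where
  "lex_min_extension m \<eta> = (THE e. binomid_extension m \<eta> e \<and>
     (\<forall>e'. binomid_extension m \<eta> e' \<longrightarrow> e = e' \<or> less_fun e e'))"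

definition partial_sum :: "(nat \<Rightarrow> nat) \<Rightarrow> nat \<Rightarrow> nat" where
  "partial_sum e i = (\<Sum>j = 1..i. e j)"

definition UKP_feasible :: "nat \<Rightarrow> (nat \<Rightarrow> nat) \<Rightarrow> nat \<Rightarrow> (nat \<Rightarrow> nat) set" where
  "UKP_feasible m w k = {c \<in> nat_seqs (enat m). (\<Sum>i = 1..m. c i * w i) \<le> k}"

definition UKP :: "nat \<Rightarrow> (nat \<Rightarrow> nat) \<Rightarrow> (nat \<Rightarrow> nat) \<Rightarrow> nat \<Rightarrow> (nat \<Rightarrow> nat) set" where
  "UKP m v w k = {c \<in> UKP_feasible m w k.
     \<forall>d \<in> UKP_feasible m w k. (\<Sum>i = 1..m. d i * v i) \<le> (\<Sum>i = 1..m. c i * v i)}"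

lemma binomid_index_extend_one:
  assumes "binomid_index (enat n) e"
  shows "binomid_index (enat (Suc n)) (e(Suc n := (\<Sum>i = 1..n. e i)))"
proof -
  let ?S = "\<Sum>i = 1..n. e i"
  let ?f = "e(Suc n := ?S)"
  have old: "(\<Sum>i\<in>A. ?f i) = (\<Sum>i\<in>A. e i)" if "A \<subseteq> {1..n}" for A
    using that by (intro sum.cong) auto
  have "(\<Sum>i = 1..k. ?f i) \<le> (\<Sum>i = l - k + 1..l. ?f i)"
    if k: "1 \<le> k" "k \<le> l" "l \<le> Suc n" for k l
  proof (cases "l = Suc n")
    case False
    then have "{1..k} \<subseteq> {1..n}" "{l - k + 1..l} \<subseteq> {1..n}" using k by auto
    then show ?thesis
      using assms k False unfolding old[OF \<open>{1..k} \<subseteq> {1..n}\<close>] old[OF \<open>{l - k + 1..l} \<subseteq> {1..n}\<close>]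
      by (simp add: binomid_index_def)
  next
    case l: True
    show ?thesis
    proof (cases "k = Suc n")
      case True
      then show ?thesis using l by simp
    next
      case False
      then have "{1..k} \<subseteq> {1..n}" using k l by auto
      then have "(\<Sum>i = 1..k. ?f i) \<le> ?S"
        unfolding old[OF \<open>{1..k} \<subseteq> {1..n}\<close>] by (intro sum_mono2) auto
      also have "?S = ?f (Suc n)" by simp
      also have "\<dots> \<le> (\<Sum>i = l - k + 1..l. ?f i)"
        using k l by (intro member_le_sum) auto
      finally show ?thesis .
    qed
  qed
  moreover have "?f \<in> nat_seqs (enat (Suc n))"
    using assms by (auto simp: binomid_index_def nat_seqs_def PiE_def extensional_def)
  ultimately show ?thesis by (auto simp: binomid_index_def)
qed

lemma binomid_index_cong:
  assumes "e \<in> nat_seqs m" "\<And>n. enat n \<le> m \<Longrightarrow> \<exists>f. binomid_index (enat n) f \<and> (\<forall>i\<in>{1..n}. e i = f i)"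
  shows "binomid_index m e"
  unfolding binomid_index_def
proof (intro conjI allI impI)
  fix k n :: nat assume k: "1 \<le> k" "k \<le> n" "enat n \<le> m"
  then obtain f where f: "binomid_index (enat n) f" "\<forall>i\<in>{1..n}. e i = f i"
    using assms(2) by blast
  have "(\<Sum>i = 1..k. e i) = (\<Sum>i = 1..k. f i)" "(\<Sum>i = n - k + 1..n. e i) = (\<Sum>i = n - k + 1..n. f i)"
    using f(2) k by (auto intro!: sum.cong)
  then show "(\<Sum>i = 1..k. e i) \<le> (\<Sum>i = n - k + 1..n. e i)"
    using f(1) k by (simp add: binomid_index_def)
qed (fact assms(1))

theorem lex_min_extension_unique:
  assumes "binomid_index (enat m) \<eta>"
  shows "\<exists>!e. binomid_extension m \<eta> e \<and>
     (\<forall>e'. binomid_extension m \<eta> e' \<longrightarrow> e = e' \<or> less_fun e e')"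
proof -
  define P where "P F n x \<longleftrightarrow> binomid_index (enat (Suc n)) (F(Suc n := x))" for F n x
  define G where "G = rec_nat \<eta> (\<lambda>j F. F(Suc (m + j) := (LEAST x. P F (m + j) x)))"
  have G0: "G 0 = \<eta>" and GS: "G (Suc j) = (G j)(Suc (m + j) := (LEAST x. P (G j) (m + j) x))" for j
    by (simp_all add: G_def)
  have GB: "binomid_index (enat (m + j)) (G j)" for j
  proof (induction j)
    case 0
    then show ?case using assms by (simp add: G0)
  next
    case (Suc j)
    have "\<exists>x. P (G j) (m + j) x"
      using binomid_index_extend_one[OF Suc] unfolding P_def by blast
    then have "P (G j) (m + j) (LEAST x. P (G j) (m + j) x)" by (rule LeastI_ex)
    then show ?case unfolding GS P_def add_Suc_right .
  qed
  have Gcoh: "G (j + d) i = G j i" if "i \<le> m + j" for i j d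
    using that by (induction d) (auto simp: GS)
  define e where "e i = G i i" for i
  have eG: "e i = G j i" if "i \<le> m + j" for i j
  proof (cases "i \<le> j")
    case True
    then obtain d where "j = i + d" using le_Suc_ex by blast
    then show ?thesis using Gcoh[of i i d] by (simp add: e_def)
  next
    case False
    then obtain d where "i = j + d" using le_Suc_ex nat_le_linear by blast
    then show ?thesis using Gcoh[of i j d] that by (simp add: e_def)
  qed
  have e0: "e 0 = undefined"
    using GB[of 0] eG[of 0 0]
    by (auto simp: binomid_index_def nat_seqs_def PiE_def extensional_def)
  have seq: "f \<in> nat_seqs \<infinity> \<longleftrightarrow> f 0 = undefined" for f
  proof -
    have "{i::nat. 1 \<le> i \<and> enat i \<le> \<infinity>} = - {0}" by auto
    then show ?thesis by (simp add: nat_seqs_def PiE_def extensional_def)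
  qed
  have "\<exists>f. binomid_index (enat n) f \<and> (\<forall>i\<in>{1..n}. e i = f i)" for n
  proof -
    define f where "f = restrict e {1..n}"
    have fs: "f \<in> nat_seqs (enat n)"
      by (auto simp: f_def nat_seqs_def PiE_def extensional_def)
    have "binomid_index (enat n) f"
      unfolding binomid_index_def
    proof (intro conjI allI impI fs)
      fix k l :: nat assume k: "1 \<le> k" "k \<le> l" "enat l \<le> enat n"
      have "(\<Sum>i = 1..k. f i) = (\<Sum>i = 1..k. G n i)"
        "(\<Sum>i = l - k + 1..l. f i) = (\<Sum>i = l - k + 1..l. G n i)"
        using k by (auto intro!: sum.cong simp: f_def eG[of _ n])
      then show "(\<Sum>i = 1..k. f i) \<le> (\<Sum>i = l - k + 1..l. f i)"
        using GB[of n] k by (simp add: binomid_index_def)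
    qed
    then show ?thesis by (auto simp: f_def)
  qed
  then have "binomid_index \<infinity> e"
    by (intro binomid_index_cong) (simp_all add: seq e0)
  moreover have "e i = \<eta> i" if "i \<le> m" for i using eG[of i 0] that by (simp add: G0)
  ultimately have ext: "binomid_extension m \<eta> e" by (simp add: binomid_extension_def)
  have min: "e = e' \<or> less_fun e e'" if e': "binomid_extension m \<eta> e'" for e'
  proof (cases "e = e'")
    case False
    define n where "n = (LEAST n. e n \<noteq> e' n)"
    have "\<exists>n. e n \<noteq> e' n" using False by auto
    then have n: "e n \<noteq> e' n" unfolding n_def by (rule LeastI_ex)
    have below: "e i = e' i" if "i < n" for i
      using not_less_Least[OF that[unfolded n_def]] by simp
    have "e' 0 = e 0"
      using e' e0 seq by (simp add: binomid_extension_def binomid_index_def)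
    then have "n \<noteq> 0" using n by metis
    moreover have "\<not> n \<le> m"
      using n e' ext \<open>n \<noteq> 0\<close> by (auto simp: binomid_extension_def)
    ultimately obtain j where j: "n = Suc (m + j)"
      by (metis less_imp_Suc_add not_le)
    let ?f = "(G j)(Suc (m + j) := e' n)"
    have f: "?f i = e' i" if "i \<le> n" for i
      using that below[of i] eG[of i j] by (auto simp: j)
    have fs: "?f \<in> nat_seqs (enat n)"
      using GB[of j] by (auto simp: binomid_index_def nat_seqs_def PiE_def extensional_def j)
    have "binomid_index (enat n) ?f"
      unfolding binomid_index_def
    proof (intro conjI allI impI fs)
      fix k l :: nat assume k: "1 \<le> k" "k \<le> l" "enat l \<le> enat n"
      have "(\<Sum>i = 1..k. ?f i) = (\<Sum>i = 1..k. e' i)"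
        using k by (intro sum.cong) (auto simp del: fun_upd_apply simp: f)
      moreover have "(\<Sum>i = l - k + 1..l. ?f i) = (\<Sum>i = l - k + 1..l. e' i)"
        using k by (intro sum.cong) (auto simp del: fun_upd_apply simp: f)
      ultimately show "(\<Sum>i = 1..k. ?f i) \<le> (\<Sum>i = l - k + 1..l. ?f i)"
        using e' k by (simp add: binomid_extension_def binomid_index_def)
    qed
    then have "P (G j) (m + j) (e' n)" by (simp add: P_def j)
    then have "(LEAST x. P (G j) (m + j) x) \<le> e' n" by (rule Least_le)
    moreover have "e n = (LEAST x. P (G j) (m + j) x)"
      using eG[of n "Suc j"] by (simp add: j GS)
    ultimately have "e n < e' n" using n by simp
    then show ?thesis using below by (auto simp: less_fun_def)
  qed simp
  have anti: False if "less_fun f g" "less_fun g f" for f g :: "nat \<Rightarrow> nat"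
  proof -
    obtain k where k: "f k < g k" "\<And>i. i < k \<Longrightarrow> f i = g i"
      using \<open>less_fun f g\<close> by (auto simp: less_fun_def)
    obtain l where l: "g l < f l" "\<And>i. i < l \<Longrightarrow> g i = f i"
      using \<open>less_fun g f\<close> by (auto simp: less_fun_def)
    show False using k(1) l(1) k(2)[of l] l(2)[of k] by (cases k l rule: linorder_cases) auto
  qed
  show ?thesis
  proof (rule ex1I[of _ e])
    show "binomid_extension m \<eta> e \<and> (\<forall>e'. binomid_extension m \<eta> e' \<longrightarrow> e = e' \<or> less_fun e e')"
      using ext min by blast
    show "f = e" if "binomid_extension m \<eta> f \<and> (\<forall>e'. binomid_extension m \<eta> e' \<longrightarrow> f = e' \<or> less_fun f e')" for f
      using that ext min anti by blast
  qed
qed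

end

theory Submission
  imports Defs
begin

text \<open>
  A sequence is a binomid index iff its partial sums \<open>S\<close> are superadditive. For the lex-minimal
  extension and \<open>n > m\<close>, moreover \<open>S n = S a + S b\<close> for some \<open>a, b \<ge> 1\<close> with \<open>a + b = n\<close>:
  otherwise \<open>S n\<close> could be lowered by 1 while all other partial sums are kept, which
  preserves superadditivity and yields a lexicographically smaller extension. Iterating
  this splitting writes \<open>S k\<close> as a combination of \<open>S 1, \<dots>, S m\<close> of weight exactly \<open>k\<close>, and
  superadditivity bounds every feasible combination by \<open>S k\<close>.
\<close>

text \<open>The last \<open>k\<close> of the first \<open>n\<close> terms sum to
  \<open>partial_sum e n - partial_sum e (n - k)\<close>, so the defining inequality for
  \<open>k\<close> and \<open>n\<close> is superadditivity at the pair \<open>n - k\<close>,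
  \<open>k\<close>. The extra case \<open>b = 0\<close> is trivial.\<close>

lemma binomid_index_infinity_iff_superadditive:
  "binomid_index \<infinity> e \<longleftrightarrow> e \<in> nat_seqs \<infinity> \<and>
     (\<forall>a b. partial_sum e a + partial_sum e b \<le> partial_sum e (a + b))"
proof -
  have tail: "partial_sum e n = partial_sum e (n - k) + (\<Sum>i = n - k + 1..n. e i)"
    if "k \<le> n" for k n
    using sum.ub_add_nat[of 1 "n - k" e k] that by (simp add: partial_sum_def)
  have "(\<forall>k n. 1 \<le> k \<longrightarrow> k \<le> n \<longrightarrow> (\<Sum>i = 1..k. e i) \<le> (\<Sum>i = n - k + 1..n. e i)) \<longleftrightarrow>
      (\<forall>a b. partial_sum e a + partial_sum e b \<le> partial_sum e (a + b))" (is "?L \<longleftrightarrow> ?R")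
  proof
    assume L: ?L
    show ?R
    proof (intro allI)
      fix a b
      show "partial_sum e a + partial_sum e b \<le> partial_sum e (a + b)"
      proof (cases "b = 0")
        case False
        then have "partial_sum e b \<le> (\<Sum>i = a + b - b + 1..a + b. e i)"
          using L[rule_format, of b "a + b"] by (simp add: partial_sum_def)
        then show ?thesis using tail[of b "a + b"] by simp
      qed (simp add: partial_sum_def)
    qed
  next
    assume R: ?R
    show ?L
    proof (intro allI impI)
      fix k n :: nat assume "1 \<le> k" "k \<le> n"
      then show "(\<Sum>i = 1..k. e i) \<le> (\<Sum>i = n - k + 1..n. e i)"
        using R[rule_format, of "n - k" k] tail[of k n] by (simp add: partial_sum_def)
    qed
  qed
  then show ?thesis by (simp add: binomid_index_def)
qed

lemma partial_sum_Suc [simp]: "partial_sum e (Suc n) = partial_sum e n + e (Suc n)"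
  by (simp add: partial_sum_def)

text \<open>Moving one unit to the next term is the perturbation that will contradict minimality.
  Positivity of the term makes the truncated subtraction exact.\<close>

lemma partial_sum_shift_one:
  assumes "e (Suc n) \<ge> 1"
  shows "partial_sum (e(Suc n := e (Suc n) - 1, Suc (Suc n) := e (Suc (Suc n)) + 1)) i =
    (if i = Suc n then partial_sum e i - 1 else partial_sum e i)"
proof (induction i)
  case 0
  then show ?case by (simp add: partial_sum_def)
next
  case (Suc i)
  then show ?case using assms by auto
qed

lemma lex_min_extension_splits:
  assumes \<eta>: "binomid_index (enat m) \<eta>" and n: "m < n" "1 < n"
  defines "S \<equiv> partial_sum (lex_min_extension m \<eta>)"
  shows "\<exists>a b. a \<ge> 1 \<and> b \<ge> 1 \<and> a + b = n \<and> S n = S a + S b"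
proof (rule ccontr)
  assume contr: "\<not> ?thesis"
  define e where "e = lex_min_extension m \<eta>"
  have ext: "binomid_extension m \<eta> e"
    and min: "\<And>f. binomid_extension m \<eta> f \<Longrightarrow> e = f \<or> less_fun e f"
    using theI'[OF lex_min_extension_unique[OF \<eta>]]
    unfolding e_def lex_min_extension_def by blast+
  have seq: "e \<in> nat_seqs \<infinity>" and super: "S a + S b \<le> S (a + b)" for a b
    using ext unfolding binomid_extension_def binomid_index_infinity_iff_superadditive
    by (auto simp: S_def e_def)
  have strict: "S a + S b < S n" if "a \<ge> 1" "b \<ge> 1" "a + b = n" for a b
    using contr super[of a b] that by (metis le_neq_implies_less)
  obtain l where l: "n = Suc l" "l \<ge> 1" using n(2) by (cases n) auto
  \<comment> \<open>Strictness for the pair \<open>l\<close>, \<open>1\<close> gives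
    \<open>S l < S n\<close>, so there is a unit to move.\<close>
  have pos: "e (Suc l) \<ge> 1"
    using strict[of l 1] l by (simp add: S_def e_def)
  define f where "f = e(Suc l := e (Suc l) - 1, Suc (Suc l) := e (Suc (Suc l)) + 1)"
  have f: "partial_sum f i = (if i = n then S i - 1 else S i)" for i
    using partial_sum_shift_one[where e = e, OF pos] by (simp add: f_def S_def e_def l)
  have "partial_sum f a + partial_sum f b \<le> partial_sum f (a + b)" for a b
  \<comment> \<open>If both parts are positive and add up to \<open>n\<close>, only the right side
    drops, by 1, and strictness absorbs this. Otherwise either the right side is unchanged or one
    part is 0.\<close>
  proof (cases "a + b = n \<and> a \<ge> 1 \<and> b \<ge> 1")
    case True
    then show ?thesis using strict[of a b] by (simp add: f)
  next
    case False
    moreover have "S 0 = 0" by (simp add: S_def partial_sum_def)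
    ultimately show ?thesis using super[of a b] by (auto simp: f)
  qed
  moreover have "f \<in> nat_seqs \<infinity>"
    using seq by (auto simp: f_def nat_seqs_def PiE_def extensional_def)
  \<comment> \<open>Both changed positions, \<open>n\<close> and \<open>n + 1\<close>, lie beyond
    \<open>m\<close>.\<close>
  moreover have "\<forall>i\<in>{1..m}. f i = \<eta> i"
    using ext n l by (auto simp: f_def binomid_extension_def)
  ultimately have "binomid_extension m \<eta> f"
    by (simp add: binomid_extension_def binomid_index_infinity_iff_superadditive)
  then have "e = f \<or> less_fun e f" by (rule min)
  moreover have "less_fun f e"
    unfolding less_fun_def using pos by (intro exI[of _ "Suc l"]) (auto simp: f_def)
  ultimately show False
    using less_fun_asym less_fun_irrefl by blast
qed

text \<open>Strong induction: up to \<open>m\<close> a unit vector works, and beyond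
  \<open>m\<close> the coefficients of the two smaller parts add up. Here \<open>m \<ge> 1\<close>
  ensures that every \<open>k > m\<close> exceeds 1, as the splitting requires.\<close>

lemma combination_of_splits:
  fixes S :: "nat \<Rightarrow> nat"
  assumes split: "\<And>n. m < n \<Longrightarrow> 1 < n \<Longrightarrow> \<exists>a b. a \<ge> 1 \<and> b \<ge> 1 \<and> a + b = n \<and> S n = S a + S b"
    and "m \<ge> 1" "k \<ge> 1"
  shows "\<exists>c. S k = (\<Sum>i = 1..m. c i * S i) \<and> k = (\<Sum>i = 1..m. c i * i)"
  using \<open>k \<ge> 1\<close>
proof (induction k rule: less_induct)
  case (less k)
  show ?case
  proof (cases "k \<le> m")
    case True
    let ?c = "\<lambda>i. of_bool (i = k)"
    have "(\<Sum>i = 1..m. ?c i * g i) = g k" for g :: "nat \<Rightarrow> nat"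
      using True less.prems by (simp add: of_bool_def if_distrib[of "\<lambda>x. x * _"] cong: if_cong)
    then show ?thesis by (intro exI[of _ ?c]) simp
  next
    case False
    then obtain a b where ab: "a \<ge> 1" "b \<ge> 1" "a + b = k" "S k = S a + S b"
      using split[of k] \<open>m \<ge> 1\<close> by auto
    obtain c d where
      "S a = (\<Sum>i = 1..m. c i * S i)" "a = (\<Sum>i = 1..m. c i * i)"
      "S b = (\<Sum>i = 1..m. d i * S i)" "b = (\<Sum>i = 1..m. d i * i)"
      using less.IH[of a] less.IH[of b] ab by auto
    then show ?thesis using ab
      by (intro exI[of _ "\<lambda>i. c i + d i"]) (simp add: algebra_simps sum.distrib)
  qed
qed

lemma superadditive_mult:
  fixes S :: "nat \<Rightarrow> nat"
  assumes "S 0 = 0" "\<And>a b. S a + S b \<le> S (a + b)"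
  shows "c * S n \<le> S (c * n)"
proof (induction c)
  case (Suc c)
  then show ?case using assms(2)[of n "c * n"] by simp
qed (simp add: assms(1))

text \<open>This yields the upper bound on the knapsack value: packing all items into one of the
  same total weight never decreases the value.\<close>

lemma superadditive_combination:
  fixes S :: "nat \<Rightarrow> nat"
  assumes "S 0 = 0" "\<And>a b. S a + S b \<le> S (a + b)"
  shows "(\<Sum>i\<in>A. d i * S i) \<le> S (\<Sum>i\<in>A. d i * i)"
proof (induction A rule: infinite_finite_induct)
  case (insert x A)
  then show ?case
    using assms(2)[of "d x * x" "\<Sum>i\<in>A. d i * i"] superadditive_mult[of S "d x" x, OF assms]
    by simp
qed (simp_all add: assms(1))

theorem proposition2p3:
  fixes m :: nat and \<eta> S :: "nat \<Rightarrow> nat"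
  assumes "m \<ge> 1"
    and "binomid_index (enat m) \<eta>"
    and "S = partial_sum (lex_min_extension m \<eta>)"
  shows "\<forall>k\<ge>1. \<exists>c \<in> UKP m S (\<lambda>i. i) k.
           S k = (\<Sum>i = 1..m. c i * S i) \<and> k = (\<Sum>i = 1..m. c i * i)"
proof (intro allI impI)
  fix k :: nat assume "k \<ge> 1"
  have "binomid_extension m \<eta> (lex_min_extension m \<eta>)"
    using theI'[OF lex_min_extension_unique[OF assms(2)]]
    unfolding lex_min_extension_def by blast
  then have super: "S a + S b \<le> S (a + b)" for a b
    unfolding binomid_extension_def binomid_index_infinity_iff_superadditive assms(3) by blast
  have S0: "S 0 = 0" by (simp add: assms(3) partial_sum_def)
  obtain c where c: "S k = (\<Sum>i = 1..m. c i * S i)" "k = (\<Sum>i = 1..m. c i * i)"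
    using combination_of_splits[OF _ \<open>m \<ge> 1\<close> \<open>k \<ge> 1\<close>] lex_min_extension_splits[OF assms(2)]
    unfolding assms(3) by blast
  \<comment> \<open>Membership in \<open>nat_seqs\<close> demands the value \<open>undefined\<close>
    outside the index set; the sums do not see this change.\<close>
  define c' where "c' = restrict c {1..m}"
  have c': "S k = (\<Sum>i = 1..m. c' i * S i)" "k = (\<Sum>i = 1..m. c' i * i)"
    using c by (simp_all add: c'_def)
  have "c' \<in> nat_seqs (enat m)"
    by (auto simp: c'_def nat_seqs_def PiE_def extensional_def)
  moreover have "(\<Sum>i = 1..m. d i * S i) \<le> S k" if "(\<Sum>i = 1..m. d i * i) \<le> k" for d
  proof -
    have "(\<Sum>i = 1..m. d i * S i) \<le> S (\<Sum>i = 1..m. d i * i)"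
      by (rule superadditive_combination[OF S0 super])
    also have "\<dots> \<le> S k"
      using super[of "\<Sum>i = 1..m. d i * i" "k - (\<Sum>i = 1..m. d i * i)"] that by simp
    finally show ?thesis .
  qed
  ultimately have "c' \<in> UKP m S (\<lambda>i. i) k"
    unfolding UKP_def UKP_feasible_def mem_Collect_eq Ball_def c'(1)[symmetric]
    using eq_refl[OF c'(2)[symmetric]] by blast
  then show "\<exists>c \<in> UKP m S (\<lambda>i. i) k.
      S k = (\<Sum>i = 1..m. c i * S i) \<and> k = (\<Sum>i = 1..m. c i * i)"
    using c' by blast
qed

end
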